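(* Let $m\in\mathbb N$, $m\ge1$. The operators $E_{jk}$ on $C^{m-1}[0,T]$ satisfy $$E_{ij}E_{k\ell}=\delta_{jk}E_{i\ell},\qquad 0\le i,j,k,\ell<m .$$ Consequently, their span is a copy of the matrix algebra $M_m(\mathbb C)$, $\Pi_m^2=\Pi_m$, $Q_m^2=Q_m$, and $$C^{m-1}[0,T]=\mathcal P_{m-1}\oplus\mathcal N_m .$$ More explicitly, every $u\in C^{m-1}[0,T]$ has the unique decomposition $u=P_{\mathbf d}+y$ (with $P_{\mathbf d}\in\mathcal P_{m-1}$, $y\in\mathcal N_m$), where $$P_{\mathbf d}=\Pi_mu=\sum_{k=0}^{m-1}d_ke_k,\qquad d_k=\varepsilon_ku,\qquad y=Q_mu\in\mathcal N_m .$$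
   Context: Fix $T>0$; functions are complex-valued. $e_k(t)=t^k/k!$ and $\varepsilon_ku=u^{(k)}(0)$ for $0\le k<m$, $u\in C^{m-1}[0,T]$. $E_{jk}=e_j\varepsilon_k$, i.e. $E_{jk}u=(\varepsilon_ku)e_j$; $\Pi_m=\sum_{k=0}^{m-1}E_{kk}$; $Q_m=I-\Pi_m$; $\mathcal P_{m-1}=\operatorname{span}\{e_0,\dots,e_{m-1}\}$; $\mathcal N_m=\bigcap_{k=0}^{m-1}\ker\varepsilon_k\subset C^{m-1}[0,T]$. *)

theory Defs
  imports
    "HOL-Analysis.Analysis"
    "HOL-Library.Function_Algebras"
    "Jordan_Normal_Form.Matrix"
begin

text \<open>A function on \<open>[0,T]\<close> is represented by its extension by zero to the real line, and a linear
  operator on a space \<open>V\<close> of such functions by its extension by zero to functions outside \<open>V\<close>.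
  Then equality of functions and of operators is plain equality, sums are the pointwise ones of
  \<open>Function_Algebras\<close>, and multiplication of operators is plain composition.\<close>

definition cscale :: "complex \<Rightarrow> (real \<Rightarrow> complex) \<Rightarrow> (real \<Rightarrow> complex)" where
  "cscale c u = (\<lambda>t. c * u t)"

definition opscale ::
  "complex \<Rightarrow> ((real \<Rightarrow> complex) \<Rightarrow> (real \<Rightarrow> complex)) \<Rightarrow> ((real \<Rightarrow> complex) \<Rightarrow> (real \<Rightarrow> complex))" where
  "opscale c A = (\<lambda>u. cscale c (A u))"

interpretation cfun: vector_space cscale
  by unfold_locales (auto simp: cscale_def fun_eq_iff algebra_simps)

interpretation cop: vector_space opscale
  by unfold_locales (auto simp: opscale_def cscale_def fun_eq_iff algebra_simps)

definition linear_ops ::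
  "(real \<Rightarrow> complex) set \<Rightarrow> ((real \<Rightarrow> complex) \<Rightarrow> (real \<Rightarrow> complex)) set" where
  "linear_ops V = {A. (\<forall>u\<in>V. A u \<in> V) \<and>
     (\<forall>u\<in>V. \<forall>v\<in>V. A (u + v) = A u + A v) \<and>
     (\<forall>c. \<forall>u\<in>V. A (cscale c u) = cscale c (A u)) \<and>
     (\<forall>u. u \<notin> V \<longrightarrow> A u = 0)}"

definition is_direct_sum ::
  "(real \<Rightarrow> complex) set \<Rightarrow> (real \<Rightarrow> complex) set \<Rightarrow> (real \<Rightarrow> complex) set \<Rightarrow> bool" where
  "is_direct_sum V A B \<longleftrightarrow> cfun.subspace A \<and> cfun.subspace B \<and>
     V = {a + b | a b. a \<in> A \<and> b \<in> B} \<and> A \<inter> B = {0}"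

text \<open>One-sided at the endpoints. Values at points outside \<open>[0,T]\<close> are meaningless and never used.\<close>

definition deriv_on :: "real \<Rightarrow> (real \<Rightarrow> complex) \<Rightarrow> (real \<Rightarrow> complex)" where
  "deriv_on T u = (\<lambda>t. vector_derivative u (at t within {0..T}))"

definition C_space :: "real \<Rightarrow> nat \<Rightarrow> (real \<Rightarrow> complex) set" where
  "C_space T n = {u. (\<forall>t. t \<notin> {0..T} \<longrightarrow> u t = 0) \<and>
     (\<forall>k<n. (deriv_on T ^^ k) u differentiable_on {0..T}) \<and>
     continuous_on {0..T} ((deriv_on T ^^ n) u)}"

definition e :: "real \<Rightarrow> nat \<Rightarrow> (real \<Rightarrow> complex)" where
  "e T k = (\<lambda>t. if t \<in> {0..T} then of_real t ^ k / fact k else 0)"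

definition eps :: "real \<Rightarrow> nat \<Rightarrow> (real \<Rightarrow> complex) \<Rightarrow> complex" where
  "eps T k u = (deriv_on T ^^ k) u 0"

text \<open>In the following operators the parameter \<open>m\<close> records the domain \<open>C\<^sup>m\<^sup>-\<^sup>1[0,T]\<close>.\<close>

definition E :: "real \<Rightarrow> nat \<Rightarrow> nat \<Rightarrow> nat \<Rightarrow> (real \<Rightarrow> complex) \<Rightarrow> (real \<Rightarrow> complex)" where
  "E T m j k = (\<lambda>u. if u \<in> C_space T (m - 1) then cscale (eps T k u) (e T j) else 0)"

definition Id_op :: "real \<Rightarrow> nat \<Rightarrow> (real \<Rightarrow> complex) \<Rightarrow> (real \<Rightarrow> complex)" where
  "Id_op T m = (\<lambda>u. if u \<in> C_space T (m - 1) then u else 0)"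

definition Pi_op :: "real \<Rightarrow> nat \<Rightarrow> (real \<Rightarrow> complex) \<Rightarrow> (real \<Rightarrow> complex)" where
  "Pi_op T m = (\<Sum>k<m. E T m k k)"

definition Q_op :: "real \<Rightarrow> nat \<Rightarrow> (real \<Rightarrow> complex) \<Rightarrow> (real \<Rightarrow> complex)" where
  "Q_op T m = Id_op T m - Pi_op T m"

definition Pol :: "real \<Rightarrow> nat \<Rightarrow> (real \<Rightarrow> complex) set" where
  "Pol T m = cfun.span (e T ` {..<m})"

definition Null :: "real \<Rightarrow> nat \<Rightarrow> (real \<Rightarrow> complex) set" where
  "Null T m = {u \<in> C_space T (m - 1). \<forall>k<m. eps T k u = 0}"

definition E_span :: "real \<Rightarrow> nat \<Rightarrow> ((real \<Rightarrow> complex) \<Rightarrow> (real \<Rightarrow> complex)) set" where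
  "E_span T m = cop.span {E T m j k | j k. j < m \<and> k < m}"

definition matrix_unit :: "nat \<Rightarrow> nat \<Rightarrow> nat \<Rightarrow> complex mat" where
  "matrix_unit m i j = mat m m (\<lambda>(a, b). if a = i \<and> b = j then 1 else 0)"

text \<open>\<open>S\<close> is a set of operators, with composition as multiplication and with unit \<open>J\<close>;
  \<open>J\<close> need not be the identity operator.\<close>

definition matrix_algebra_iso ::
  "nat \<Rightarrow> ((real \<Rightarrow> complex) \<Rightarrow> (real \<Rightarrow> complex)) set \<Rightarrow> ((real \<Rightarrow> complex) \<Rightarrow> (real \<Rightarrow> complex))
    \<Rightarrow> (complex mat \<Rightarrow> (real \<Rightarrow> complex) \<Rightarrow> (real \<Rightarrow> complex)) \<Rightarrow> bool" where
  "matrix_algebra_iso m S J \<Phi> \<longleftrightarrow>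
     bij_betw \<Phi> (carrier_mat m m) S \<and>
     (\<forall>A\<in>carrier_mat m m. \<forall>B\<in>carrier_mat m m. \<Phi> (A + B) = \<Phi> A + \<Phi> B) \<and>
     (\<forall>c. \<forall>A\<in>carrier_mat m m. \<Phi> (c \<cdot>\<^sub>m A) = opscale c (\<Phi> A)) \<and>
     (\<forall>A\<in>carrier_mat m m. \<forall>B\<in>carrier_mat m m. \<Phi> (A * B) = \<Phi> A \<circ> \<Phi> B) \<and>
     \<Phi> (1\<^sub>m m) = J"

end

theory Submission
  imports Defs
begin

text \<open>
  Everything rests on the duality \<open>eps k (e j) = (if k = j then 1 else 0)\<close> of the monomials and the
  Taylor functionals, which are linear on \<open>C_space T (m - 1)\<close>.  It says that the coordinates
  of \<open>\<Sum>j<m. c j e\<^sub>j\<close> under the functionals are the \<open>c j\<close> themselves.  Hence the operator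
  \<open>\<Sum>i j. A\<^sub>i\<^sub>j E\<^sub>i\<^sub>j\<close> (\<open>matrix_op\<close> below) sends a function with coordinates \<open>x\<close> to the polynomial with
  coordinates \<open>A x\<close>, so that composition of operators is multiplication of matrices and the matrix
  can be recovered from the operator by applying it to the \<open>e\<^sub>j\<close>.

  The projection \<open>Pi_op\<close> is the operator of the unit matrix, therefore idempotent.  It keeps the
  coordinates of its argument and fixes polynomials; so its complement \<open>Q_op\<close> has
  range in the common kernel of the functionals, and a decomposition \<open>u = p + y\<close> has to have
  \<open>p = Pi_op p = Pi_op u\<close>.

  The analytic part is the control of iterated one-sided derivatives on \<open>[0,T]\<close>:
  \<open>iterated_deriv_on_eq\<close> computes them from any chain of functions each of which
  is the derivative of its predecessor.
\<close>

section \<open>Iterated derivatives on an interval\<close>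

text \<open>The chain \<open>F\<close> need not agree with the iterates of \<open>deriv_on\<close> outside \<open>[0,T]\<close>, where these have
  arbitrary values.  A derivative within \<open>[0,T]\<close> at a point of \<open>[0,T]\<close> does not see those values,
  and it is unique because the interval is nondegenerate.\<close>

lemma
  fixes F :: "nat \<Rightarrow> real \<Rightarrow> complex"
  assumes T: "T > 0"
    and F0: "\<And>t. t \<in> {0..T} \<Longrightarrow> u t = F 0 t"
    and F: "\<And>k t. k < n \<Longrightarrow> t \<in> {0..T} \<Longrightarrow>
      (F k has_vector_derivative F (Suc k) t) (at t within {0..T})"
  shows iterated_deriv_on_eq:
      "k \<le> n \<Longrightarrow> t \<in> {0..T} \<Longrightarrow> (deriv_on T ^^ k) u t = F k t"
    and iterated_deriv_on_has_derivative:
      "k < n \<Longrightarrow> t \<in> {0..T} \<Longrightarrow>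
        ((deriv_on T ^^ k) u has_vector_derivative F (Suc k) t) (at t within {0..T})"
proof -
  have step: "((deriv_on T ^^ k) u has_vector_derivative F (Suc k) t) (at t within {0..T})"
    if "k < n" "t \<in> {0..T}" "\<And>s. s \<in> {0..T} \<Longrightarrow> (deriv_on T ^^ k) u s = F k s" for k t
    by (rule has_vector_derivative_transform[OF that(2) _ F[OF that(1,2)]]) (simp add: that(3))
  have eq: "\<forall>t\<in>{0..T}. (deriv_on T ^^ k) u t = F k t" if "k \<le> n" for k
    using that
  proof (induction k)
    case 0
    then show ?case by (simp add: F0)
  next
    case (Suc k)
    show ?case
    proof
      fix t assume t: "t \<in> {0..T}"
      have "((deriv_on T ^^ k) u has_vector_derivative F (Suc k) t) (at t within {0..T})"
        using Suc by (intro step t) auto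
      then have "vector_derivative ((deriv_on T ^^ k) u) (at t within {0..T}) = F (Suc k) t"
        using T t by (intro vector_derivative_within_closed_interval) auto
      then show "(deriv_on T ^^ Suc k) u t = F (Suc k) t"
        by (simp add: deriv_on_def)
    qed
  qed
  show "k \<le> n \<Longrightarrow> t \<in> {0..T} \<Longrightarrow> (deriv_on T ^^ k) u t = F k t"
    using eq by blast
  show "k < n \<Longrightarrow> t \<in> {0..T} \<Longrightarrow>
      ((deriv_on T ^^ k) u has_vector_derivative F (Suc k) t) (at t within {0..T})"
    by (rule step) (use eq in auto)
qed

lemma C_spaceI_derivative_chain:
  fixes F :: "nat \<Rightarrow> real \<Rightarrow> complex"
  assumes T: "T > 0"
    and zero: "\<And>t. t \<notin> {0..T} \<Longrightarrow> u t = 0"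
    and F0: "\<And>t. t \<in> {0..T} \<Longrightarrow> u t = F 0 t"
    and F: "\<And>k t. k < n \<Longrightarrow> t \<in> {0..T} \<Longrightarrow>
      (F k has_vector_derivative F (Suc k) t) (at t within {0..T})"
    and cont: "continuous_on {0..T} (F n)"
  shows "u \<in> C_space T n"
proof -
  have "(deriv_on T ^^ k) u differentiable_on {0..T}" if "k < n" for k
    unfolding differentiable_on_def
    using iterated_deriv_on_has_derivative[OF T F0 F that]
    by (meson differentiableI_vector)
  moreover have "continuous_on {0..T} ((deriv_on T ^^ n) u)"
    by (rule continuous_on_eq[OF cont]) (metis iterated_deriv_on_eq[OF T F0 F] order_refl)
  ultimately show ?thesis
    using zero by (simp add: C_space_def)
qed

lemma C_space_has_derivative:
  assumes "u \<in> C_space T n" "k < n" "t \<in> {0..T}"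
  shows "((deriv_on T ^^ k) u has_vector_derivative (deriv_on T ^^ Suc k) u t) (at t within {0..T})"
  using assms
  by (auto simp: C_space_def differentiable_on_def deriv_on_def vector_derivative_works[symmetric])

section \<open>Linearity of the Taylor functionals\<close>

lemma
  assumes T: "T > 0" and u: "u \<in> C_space T n" and v: "v \<in> C_space T n"
  shows C_space_add: "u + v \<in> C_space T n"
    and eps_add: "k \<le> n \<Longrightarrow> eps T k (u + v) = eps T k u + eps T k v"
proof -
  let ?F = "\<lambda>k t. (deriv_on T ^^ k) u t + (deriv_on T ^^ k) v t"
  have F: "(?F k has_vector_derivative ?F (Suc k) t) (at t within {0..T})"
    if "k < n" "t \<in> {0..T}" for k t
    by (intro has_vector_derivative_add C_space_has_derivative[OF u that]
        C_space_has_derivative[OF v that])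
  show "u + v \<in> C_space T n"
    by (rule C_spaceI_derivative_chain[OF T, where F = ?F])
      (use u v F in \<open>auto simp: C_space_def intro!: continuous_intros\<close>)
  show "k \<le> n \<Longrightarrow> eps T k (u + v) = eps T k u + eps T k v"
    unfolding eps_def by (rule iterated_deriv_on_eq[OF T, where F = ?F]) (use T F in auto)
qed

lemma
  assumes T: "T > 0" and u: "u \<in> C_space T n"
  shows C_space_cscale: "cscale c u \<in> C_space T n"
    and eps_cscale: "k \<le> n \<Longrightarrow> eps T k (cscale c u) = c * eps T k u"
proof -
  let ?F = "\<lambda>k t. c * (deriv_on T ^^ k) u t"
  have F: "(?F k has_vector_derivative ?F (Suc k) t) (at t within {0..T})"
    if "k < n" "t \<in> {0..T}" for k t
    by (rule has_vector_derivative_mult_right[OF C_space_has_derivative[OF u that]])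
  show "cscale c u \<in> C_space T n"
    by (rule C_spaceI_derivative_chain[OF T, where F = ?F])
      (use u F in \<open>auto simp: C_space_def cscale_def intro!: continuous_intros\<close>)
  show "k \<le> n \<Longrightarrow> eps T k (cscale c u) = c * eps T k u"
    unfolding eps_def
    by (rule iterated_deriv_on_eq[OF T, where F = ?F]) (use T F in \<open>auto simp: cscale_def\<close>)
qed

lemma C_space_zero: "T > 0 \<Longrightarrow> 0 \<in> C_space T n"
  by (rule C_spaceI_derivative_chain[where F = "\<lambda>k t. 0"]) auto

lemma C_space_subspace: "T > 0 \<Longrightarrow> cfun.subspace (C_space T n)"
  by (simp add: cfun.subspace_def C_space_zero C_space_add C_space_cscale)

lemma eps_zero:
  assumes T: "T > 0"
  shows "eps T k 0 = 0"
  using eps_cscale[OF T C_space_zero[OF T] order_refl, of k 0]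
  by (simp only: cfun.scale_zero_left mult_zero_left)

lemma eps_diff:
  assumes T: "T > 0" and u: "u \<in> C_space T n" and v: "v \<in> C_space T n" and k: "k \<le> n"
  shows "eps T k (u - v) = eps T k u - eps T k v"
proof -
  have "u - v \<in> C_space T n"
    using u v by (intro cfun.subspace_diff C_space_subspace T)
  then show ?thesis
    using eps_add[OF T _ v k, of "u - v"] by simp
qed

lemma eps_sum:
  assumes T: "T > 0" and f: "\<And>i. i \<in> I \<Longrightarrow> f i \<in> C_space T n" and k: "k \<le> n"
  shows "eps T k (sum f I) = (\<Sum>i\<in>I. eps T k (f i))"
  using f
proof (induction I rule: infinite_finite_induct)
  case (insert i I)
  have "sum f I \<in> C_space T n"
    using insert.prems by (intro cfun.subspace_sum C_space_subspace T) auto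
  then have "eps T k (f i + sum f I) = eps T k (f i) + eps T k (sum f I)"
    using insert.prems by (intro eps_add[OF T _ _ k]) auto
  then show ?case
    using insert.IH insert.prems by (simp only: sum.insert[OF insert.hyps] insert_iff simp_thms)
qed (simp_all add: eps_zero T)

section \<open>Duality with the monomials\<close>

lemma
  assumes T: "T > 0"
  shows monomial_in_C_space: "e T j \<in> C_space T n"
    and eps_monomial: "eps T k (e T j) = (if k = j then 1 else 0)"
proof -
  define F :: "nat \<Rightarrow> real \<Rightarrow> complex"
    where "F k t = (if k \<le> j then of_real t ^ (j - k) / fact (j - k) else 0)" for k t
  have F: "(F k has_vector_derivative F (Suc k) t) (at t within {0..T})" for k t
  proof (cases "k < j")
    case True
    then obtain i where i: "j - k = Suc i" "j - Suc k = i"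
      by (metis Suc_diff_Suc)
    have "((\<lambda>z::complex. z ^ Suc i / fact (Suc i)) has_field_derivative
        of_real t ^ i / fact i) (at (of_real t))"
      by (auto intro!: derivative_eq_intros simp: divide_simps fact_Suc simp del: power_Suc of_nat_Suc)
    then have "((\<lambda>t. of_real t ^ Suc i / fact (Suc i)) has_vector_derivative
        (of_real t ^ i / fact i :: complex)) (at t within {0..T})"
      by (rule has_vector_derivative_real_field)
    moreover have "F k = (\<lambda>t. of_real t ^ Suc i / fact (Suc i))" "F (Suc k) t = of_real t ^ i / fact i"
      using True i by (auto simp: F_def fun_eq_iff simp del: power_Suc fact_Suc)
    ultimately show ?thesis
      by (simp only:)
  next
    case False
    then have "F k = (\<lambda>t. if k = j then 1 else 0)" "F (Suc k) t = 0"
      by (auto simp: F_def)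
    then show ?thesis by simp
  qed
  have F0: "e T j t = F 0 t" if "t \<in> {0..T}" for t
    using that by (simp add: e_def F_def)
  have "continuous_on {0..T} (F n)"
    using F by (intro continuous_on_vector_derivative) blast
  then show "e T j \<in> C_space T n"
    by (intro C_spaceI_derivative_chain[OF T _ F0 F]) (auto simp: e_def)
  have "eps T k (e T j) = F k 0"
    unfolding eps_def using T by (intro iterated_deriv_on_eq[OF T F0 F order_refl]) auto
  then show "eps T k (e T j) = (if k = j then 1 else 0)"
    by (simp add: F_def)
qed

text \<open>The operators use the functionals of index \<open>k < m\<close> on the space of order \<open>m - 1\<close>; this puts
  them in the range of indices where \<open>eps_add\<close> and \<open>eps_cscale\<close> give linearity.\<close>

lemma lessThan_imp_le_pred: "k < m \<Longrightarrow> k \<le> m - 1" for m :: nat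
  by simp

lemma polynomial_in_C_space:
  "T > 0 \<Longrightarrow> (\<Sum>j<m. cscale (c j) (e T j)) \<in> C_space T n"
  by (intro cfun.subspace_sum C_space_subspace C_space_cscale monomial_in_C_space)

lemma eps_polynomial:
  assumes T: "T > 0" and k: "k < m"
  shows "eps T k (\<Sum>j<m. cscale (c j) (e T j)) = c k"
proof -
  have "eps T k (\<Sum>j<m. cscale (c j) (e T j)) = (\<Sum>j<m. c j * eps T k (e T j))"
    by (simp add: eps_sum[OF T _ order_refl] eps_cscale[OF T _ order_refl]
        C_space_cscale monomial_in_C_space T)
  also have "\<dots> = c k"
    using k by (simp add: eps_monomial T if_distrib sum.delta cong: if_cong)
  finally show ?thesis .
qed

section \<open>The operator of a matrix\<close>

definition matrix_op ::
  "real \<Rightarrow> nat \<Rightarrow> complex mat \<Rightarrow> (real \<Rightarrow> complex) \<Rightarrow> (real \<Rightarrow> complex)" where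
  "matrix_op T m A = (\<Sum>i<m. \<Sum>j<m. opscale (A $$ (i, j)) (E T m i j))"

lemma sum_fun_apply: "(\<Sum>i\<in>I. f i) x = (\<Sum>i\<in>I. f i x)"
  for f :: "'i \<Rightarrow> 'a \<Rightarrow> 'b::comm_monoid_add"
  by (induction I rule: infinite_finite_induct) auto

lemma matrix_op_outside: "u \<notin> C_space T (m - 1) \<Longrightarrow> matrix_op T m A u = 0"
  by (simp add: matrix_op_def sum_fun_apply opscale_def E_def)

text \<open>The coefficients here are the product of \<open>A\<close> with the coordinate vector of \<open>u\<close>; this form
  reduces composition of operators to associativity of matrix-vector products.\<close>

lemma matrix_op_apply:
  assumes "u \<in> C_space T (m - 1)"
  shows "matrix_op T m A u = (\<Sum>i<m. cscale (\<Sum>j<m. A $$ (i, j) * eps T j u) (e T i))"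
  using assms by (simp add: matrix_op_def sum_fun_apply opscale_def E_def cfun.scale_sum_left)

lemma eps_matrix_op:
  assumes "T > 0" "i < m" "u \<in> C_space T (m - 1)"
  shows "eps T i (matrix_op T m A u) = (\<Sum>j<m. A $$ (i, j) * eps T j u)"
  using assms by (simp add: matrix_op_apply eps_polynomial)

lemma matrix_op_in_C_space: "T > 0 \<Longrightarrow> matrix_op T m A u \<in> C_space T (m - 1)"
  by (cases "u \<in> C_space T (m - 1)")
    (simp_all add: matrix_op_apply polynomial_in_C_space matrix_op_outside C_space_zero)

lemma matrix_op_add:
  assumes "A \<in> carrier_mat m m" "B \<in> carrier_mat m m"
  shows "matrix_op T m (A + B) = matrix_op T m A + matrix_op T m B"
  using assms by (simp add: matrix_op_def cop.scale_left_distrib sum.distrib)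

lemma matrix_op_smult:
  assumes "A \<in> carrier_mat m m"
  shows "matrix_op T m (c \<cdot>\<^sub>m A) = opscale c (matrix_op T m A)"
  using assms by (simp add: matrix_op_def cop.scale_sum_right)

lemma matrix_op_mult:
  assumes T: "T > 0" and A: "A \<in> carrier_mat m m" and B: "B \<in> carrier_mat m m"
  shows "matrix_op T m (A * B) = matrix_op T m A \<circ> matrix_op T m B"
proof
  fix u
  show "matrix_op T m (A * B) u = (matrix_op T m A \<circ> matrix_op T m B) u"
  proof (cases "u \<in> C_space T (m - 1)")
    case True
    have "(\<Sum>l<m. (A * B) $$ (i, l) * eps T l u)
        = (\<Sum>j<m. A $$ (i, j) * (\<Sum>l<m. B $$ (j, l) * eps T l u))" if "i < m" for i
    proof -
      have "(A * B) $$ (i, l) = (\<Sum>j<m. A $$ (i, j) * B $$ (j, l))" if "l < m" for l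
        using A B \<open>i < m\<close> that by (simp add: scalar_prod_def atLeast0LessThan)
      then have "(\<Sum>l<m. (A * B) $$ (i, l) * eps T l u)
          = (\<Sum>l<m. \<Sum>j<m. A $$ (i, j) * (B $$ (j, l) * eps T l u))"
        by (simp add: sum_distrib_right mult.assoc)
      also have "\<dots> = (\<Sum>j<m. \<Sum>l<m. A $$ (i, j) * (B $$ (j, l) * eps T l u))"
        by (rule sum.swap)
      finally show ?thesis
        by (simp add: sum_distrib_left)
    qed
    moreover have "matrix_op T m A (matrix_op T m B u)
        = (\<Sum>i<m. cscale (\<Sum>j<m. A $$ (i, j) * (\<Sum>l<m. B $$ (j, l) * eps T l u)) (e T i))"
      unfolding matrix_op_apply[OF matrix_op_in_C_space[OF T]]
      by (simp add: eps_matrix_op[OF T _ True])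
    ultimately show ?thesis
      by (simp add: matrix_op_apply[OF True])
  next
    case False
    have "matrix_op T m A 0 = 0"
      by (simp add: matrix_op_apply[OF C_space_zero[OF T]] eps_zero[OF T])
    with False show ?thesis
      by (simp add: matrix_op_outside)
  qed
qed

text \<open>Duality makes the coordinate vector of \<open>e\<^sub>j\<close> the \<open>j\<close>-th unit vector, which picks out the \<open>j\<close>-th
  column of \<open>A\<close>; so the operator determines the matrix.\<close>

lemma eps_matrix_op_monomial:
  assumes T: "T > 0" and "i < m" "j < m"
  shows "eps T i (matrix_op T m A (e T j)) = A $$ (i, j)"
  using assms
  by (simp add: eps_matrix_op monomial_in_C_space eps_monomial if_distrib sum.delta cong: if_cong)

lemma matrix_op_inj_on:
  assumes "T > 0"
  shows "inj_on (matrix_op T m) (carrier_mat m m)"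
proof (rule inj_onI)
  fix A B assume AB: "A \<in> carrier_mat m m" "B \<in> carrier_mat m m"
    and eq: "matrix_op T m A = matrix_op T m B"
  have "A $$ (i, j) = B $$ (i, j)" if "i < m" "j < m" for i j
    using eps_matrix_op_monomial[OF assms that] eq by metis
  then show "A = B"
    using AB by (intro eq_matI) auto
qed

lemma matrix_op_unit:
  assumes "i < m" "j < m"
  shows "matrix_op T m (matrix_unit m i j) = E T m i j"
proof -
  have "matrix_op T m (matrix_unit m i j)
      = (\<Sum>a<m. \<Sum>b<m. if a = i \<and> b = j then E T m i j else 0)"
    unfolding matrix_op_def by (intro sum.cong refl) (auto simp: matrix_unit_def)
  also have "\<dots> = (\<Sum>a<m. if a = i then (\<Sum>b<m. if b = j then E T m i j else 0) else 0)"
    by (intro sum.cong refl) auto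
  finally show ?thesis
    using assms by simp
qed

lemma matrix_op_one: "matrix_op T m (1\<^sub>m m) = Pi_op T m"
proof -
  have "matrix_op T m (1\<^sub>m m) = (\<Sum>i<m. \<Sum>j<m. if i = j then E T m i i else 0)"
    unfolding matrix_op_def by (intro sum.cong refl) auto
  then show ?thesis
    by (simp add: Pi_op_def)
qed

text \<open>The image of the matrices is a subspace and contains the generators of the span.\<close>

lemma matrix_op_image: "matrix_op T m ` carrier_mat m m = E_span T m"
proof
  show "matrix_op T m ` carrier_mat m m \<subseteq> E_span T m"
    unfolding E_span_def matrix_op_def
    by (intro image_subsetI cop.span_sum cop.span_scale cop.span_base) auto
  have "0 = matrix_op T m (0\<^sub>m m m)"
    by (simp add: matrix_op_def)
  then have "cop.subspace (matrix_op T m ` carrier_mat m m)"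
    unfolding cop.subspace_def
    by (auto simp: matrix_op_add[symmetric] matrix_op_smult[symmetric] intro!: imageI)
  moreover have "E T m j k \<in> matrix_op T m ` carrier_mat m m" if "j < m" "k < m" for j k
    using matrix_op_unit[OF that, of T, symmetric]
    by (rule image_eqI) (simp add: matrix_unit_def)
  ultimately show "E_span T m \<subseteq> matrix_op T m ` carrier_mat m m"
    unfolding E_span_def by (intro cop.span_minimal) auto
qed

lemma matrix_algebra_iso_matrix_op:
  assumes "T > 0"
  shows "matrix_algebra_iso m (E_span T m) (Pi_op T m) (matrix_op T m)"
  using assms
  by (simp add: matrix_algebra_iso_def bij_betw_def matrix_op_inj_on matrix_op_image
      matrix_op_add matrix_op_smult matrix_op_mult matrix_op_one)

section \<open>The matrix units as operators\<close>

lemma E_linear: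
  assumes T: "T > 0" and k: "k < m"
  shows "E T m j k \<in> linear_ops (C_space T (m - 1))"
  using assms lessThan_imp_le_pred[OF k]
  by (auto simp: linear_ops_def E_def C_space_add C_space_cscale monomial_in_C_space
      eps_add eps_cscale cfun.scale_left_distrib)

lemma E_comp:
  assumes T: "T > 0"
  shows "E T m i j \<circ> E T m k l = (if j = k then E T m i l else 0)"
proof
  fix u
  have "eps T j (cscale c (e T k)) = (if j = k then c else 0)" for c
    by (simp add: eps_cscale[OF T monomial_in_C_space[OF T] order_refl] eps_monomial T)
  from this[of "eps T l u"]
  show "(E T m i j \<circ> E T m k l) u = (if j = k then E T m i l else 0) u"
    by (cases "j = k")
      (simp_all add: E_def C_space_cscale monomial_in_C_space T C_space_zero eps_zero)
qed

section \<open>The projections and the direct sum\<close>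

lemma Pi_op_apply:
  "u \<in> C_space T (m - 1) \<Longrightarrow> Pi_op T m u = (\<Sum>k<m. cscale (eps T k u) (e T k))"
  by (simp add: Pi_op_def sum_fun_apply E_def)

lemma Q_op_apply: "u \<in> C_space T (m - 1) \<Longrightarrow> Q_op T m u = u - Pi_op T m u"
  by (simp add: Q_op_def Id_op_def)

lemma Pi_op_in_Pol: "u \<in> C_space T (m - 1) \<Longrightarrow> Pi_op T m u \<in> Pol T m"
  unfolding Pi_op_apply Pol_def by (intro cfun.span_sum cfun.span_scale cfun.span_base) auto

lemma Pi_op_idem: "T > 0 \<Longrightarrow> Pi_op T m \<circ> Pi_op T m = Pi_op T m"
  using matrix_op_mult[of T "1\<^sub>m m" m "1\<^sub>m m"] by (simp add: matrix_op_one)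

lemma Q_op_in_Null:
  assumes T: "T > 0" and u: "u \<in> C_space T (m - 1)"
  shows "Q_op T m u \<in> Null T m"
proof -
  have Pi: "Pi_op T m u \<in> C_space T (m - 1)"
    using u T by (simp add: Pi_op_apply polynomial_in_C_space)
  have "eps T k (u - Pi_op T m u) = 0" if "k < m" for k
    using eps_diff[OF T u Pi lessThan_imp_le_pred[OF that]] eps_polynomial[OF T that]
    by (simp add: Pi_op_apply[OF u])
  then show ?thesis
    using u Pi T by (simp add: Q_op_apply Null_def cfun.subspace_diff C_space_subspace)
qed

lemma Null_subset_C_space: "Null T m \<subseteq> C_space T (m - 1)"
  by (auto simp: Null_def)

lemma Null_subspace: "T > 0 \<Longrightarrow> cfun.subspace (Null T m)"
  by (auto simp: cfun.subspace_def Null_def C_space_zero C_space_add C_space_cscale eps_zero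
      eps_add eps_cscale lessThan_imp_le_pred)

lemma Pi_op_Null: "y \<in> Null T m \<Longrightarrow> Pi_op T m y = 0"
  by (simp add: Null_def Pi_op_apply)

lemma Pi_op_add:
  assumes "T > 0" "u \<in> C_space T (m - 1)" "v \<in> C_space T (m - 1)"
  shows "Pi_op T m (u + v) = Pi_op T m u + Pi_op T m v"
  using assms
  by (simp add: Pi_op_apply C_space_add eps_add lessThan_imp_le_pred cfun.scale_left_distrib
      sum.distrib)

lemma Q_op_idem:
  assumes T: "T > 0"
  shows "Q_op T m \<circ> Q_op T m = Q_op T m"
proof
  fix u
  show "(Q_op T m \<circ> Q_op T m) u = Q_op T m u"
  proof (cases "u \<in> C_space T (m - 1)")
    case True
    have N: "Q_op T m u \<in> Null T m"
      by (rule Q_op_in_Null[OF T True])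
    then have "Q_op T m (Q_op T m u) = Q_op T m u"
      using Null_subset_C_space by (subst Q_op_apply) (auto simp: Pi_op_Null)
    then show ?thesis by simp
  next
    case False
    then have "Q_op T m u = 0"
      by (simp add: Q_op_def Id_op_def Pi_op_def sum_fun_apply E_def)
    moreover have "Q_op T m 0 = 0"
      using T by (simp add: Q_op_apply C_space_zero Pi_op_apply eps_zero)
    ultimately show ?thesis by simp
  qed
qed

text \<open>The functions fixed by \<open>Pi_op\<close> form a subspace and contain the monomials by duality.\<close>

lemma Pol_fixed:
  assumes T: "T > 0" and p: "p \<in> Pol T m"
  shows "p \<in> C_space T (m - 1)" and "Pi_op T m p = p"
proof -
  let ?S = "{p \<in> C_space T (m - 1). Pi_op T m p = p}"
  have "Pi_op T m (cscale c u) = cscale c (Pi_op T m u)" if "u \<in> C_space T (m - 1)" for c u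
    using that T
    by (simp add: Pi_op_apply C_space_cscale eps_cscale lessThan_imp_le_pred cfun.scale_sum_right)
  then have "cfun.subspace ?S"
    using T by (auto simp: cfun.subspace_def C_space_zero C_space_add C_space_cscale Pi_op_add
        Pi_op_apply[OF C_space_zero] eps_zero)
  moreover have "Pi_op T m (e T k) = e T k" if "k < m" for k
  proof -
    have "Pi_op T m (e T k) = (\<Sum>j<m. if j = k then e T k else 0)"
      unfolding Pi_op_apply[OF monomial_in_C_space[OF T]]
      by (intro sum.cong refl) (simp add: eps_monomial T)
    then show ?thesis
      using that by simp
  qed
  ultimately have "Pol T m \<subseteq> ?S"
    unfolding Pol_def by (intro cfun.span_minimal) (auto simp: monomial_in_C_space T)
  then show "p \<in> C_space T (m - 1)" and "Pi_op T m p = p"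
    using p by auto
qed

lemma decomposition_unique:
  assumes T: "T > 0" and p: "p \<in> Pol T m" and y: "y \<in> Null T m"
  shows "Pi_op T m (p + y) = p" and "Q_op T m (p + y) = y"
proof -
  have C: "p \<in> C_space T (m - 1)" "y \<in> C_space T (m - 1)"
    using Pol_fixed[OF T p] y Null_subset_C_space by auto
  then show Pi: "Pi_op T m (p + y) = p"
    by (simp add: Pi_op_add T Pi_op_Null[OF y] Pol_fixed[OF T p])
  show "Q_op T m (p + y) = y"
    using C by (simp add: Q_op_apply C_space_add T Pi)
qed

lemma C_space_direct_sum:
  assumes T: "T > 0"
  shows "is_direct_sum (C_space T (m - 1)) (Pol T m) (Null T m)"
proof -
  have "u = Pi_op T m u + Q_op T m u" if "u \<in> C_space T (m - 1)" for u
    using that by (simp add: Q_op_apply)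
  then have "C_space T (m - 1) = {a + b | a b. a \<in> Pol T m \<and> b \<in> Null T m}"
    using Pi_op_in_Pol Q_op_in_Null[OF T] Pol_fixed(1)[OF T] Null_subset_C_space C_space_add[OF T]
    by blast
  moreover have "cfun.subspace (Pol T m)"
    by (simp add: Pol_def)
  moreover have "Pol T m \<inter> Null T m = {0}"
  proof -
    have "u = 0" if "u \<in> Pol T m" "u \<in> Null T m" for u
      using Pol_fixed(2)[OF T that(1)] Pi_op_Null[OF that(2)] by simp
    moreover have "0 \<in> Pol T m" "0 \<in> Null T m"
      using calculation \<open>cfun.subspace (Pol T m)\<close> Null_subspace[OF T] cfun.subspace_0 by blast+
    ultimately show ?thesis by blast
  qed
  ultimately show ?thesis
    using Null_subspace[OF T] by (simp add: is_direct_sum_def)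
qed

theorem proposition2:
  fixes T :: real and m :: nat
  assumes "T > 0" and "m \<ge> 1"
  shows "(\<forall>j<m. \<forall>k<m. E T m j k \<in> linear_ops (C_space T (m - 1)))
    \<and> (\<forall>i<m. \<forall>j<m. \<forall>k<m. \<forall>l<m.
         E T m i j \<circ> E T m k l = (if j = k then E T m i l else 0))
    \<and> (\<exists>\<Phi>. matrix_algebra_iso m (E_span T m) (Pi_op T m) \<Phi> \<and>
         (\<forall>i<m. \<forall>j<m. \<Phi> (matrix_unit m i j) = E T m i j))
    \<and> Pi_op T m \<circ> Pi_op T m = Pi_op T m
    \<and> Q_op T m \<circ> Q_op T m = Q_op T m
    \<and> is_direct_sum (C_space T (m - 1)) (Pol T m) (Null T m)
    \<and> (\<forall>u\<in>C_space T (m - 1).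
         u = Pi_op T m u + Q_op T m u \<and>
         Pi_op T m u \<in> Pol T m \<and>
         Q_op T m u \<in> Null T m \<and>
         Pi_op T m u = (\<Sum>k<m. cscale (eps T k u) (e T k)) \<and>
         (\<forall>p\<in>Pol T m. \<forall>y\<in>Null T m. u = p + y \<longrightarrow> p = Pi_op T m u \<and> y = Q_op T m u))"
proof (intro conjI)
  note T = \<open>T > 0\<close>
  show "\<forall>j<m. \<forall>k<m. E T m j k \<in> linear_ops (C_space T (m - 1))"
    using E_linear[OF T] by blast
  show "\<forall>i<m. \<forall>j<m. \<forall>k<m. \<forall>l<m. E T m i j \<circ> E T m k l = (if j = k then E T m i l else 0)"
    using E_comp[OF T] by blast
  show "\<exists>\<Phi>. matrix_algebra_iso m (E_span T m) (Pi_op T m) \<Phi> \<and>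
      (\<forall>i<m. \<forall>j<m. \<Phi> (matrix_unit m i j) = E T m i j)"
    using matrix_algebra_iso_matrix_op[OF T] matrix_op_unit by blast
  show "Pi_op T m \<circ> Pi_op T m = Pi_op T m"
    by (rule Pi_op_idem[OF T])
  show "Q_op T m \<circ> Q_op T m = Q_op T m"
    by (rule Q_op_idem[OF T])
  show "is_direct_sum (C_space T (m - 1)) (Pol T m) (Null T m)"
    by (rule C_space_direct_sum[OF T])
  show "\<forall>u\<in>C_space T (m - 1).
         u = Pi_op T m u + Q_op T m u \<and>
         Pi_op T m u \<in> Pol T m \<and>
         Q_op T m u \<in> Null T m \<and>
         Pi_op T m u = (\<Sum>k<m. cscale (eps T k u) (e T k)) \<and>
         (\<forall>p\<in>Pol T m. \<forall>y\<in>Null T m. u = p + y \<longrightarrow> p = Pi_op T m u \<and> y = Q_op T m u)"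
  proof (intro ballI conjI impI)
    fix u assume u: "u \<in> C_space T (m - 1)"
    show "u = Pi_op T m u + Q_op T m u"
      by (simp add: Q_op_apply[OF u])
    show "Pi_op T m u \<in> Pol T m" "Q_op T m u \<in> Null T m"
      using Pi_op_in_Pol[OF u] Q_op_in_Null[OF T u] by auto
    show "Pi_op T m u = (\<Sum>k<m. cscale (eps T k u) (e T k))"
      by (rule Pi_op_apply[OF u])
    fix p y assume "p \<in> Pol T m" "y \<in> Null T m" "u = p + y"
    then show "p = Pi_op T m u" "y = Q_op T m u"
      using decomposition_unique[OF T] by auto
  qed
qed

end
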